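(* Let $\mathcal{A}\in\mathbb{C}^{n\times n\times n\times n}$ be a conjugate partial-symmetric tensor. Then $\mathcal{A}$ can be decomposed as $$\mathcal{A}=\sum_{i=1}^r\lambda_i\,E_i\circ\overline{E_i},$$ where $r\ge 0$ is an integer, the $\lambda_i\in\mathbb{R}$ are nonzero, the $E_i\in\mathbb{C}^{n\times n}$ are symmetric matrices ($E_i^T=E_i$), and $\langle E_i,E_j\rangle=\delta_{ij}$ for $i,j=1,\dots,r$. Moreover, if the $\lambda_i$ are pairwise different, this decomposition is unique, up to reordering the terms and multiplying each $E_i$ by a complex number of modulus one.
   Context: A tensor $\mathcal{A}\in\mathbb{C}^{n\times n\times n\times n}$ is conjugate partial-symmetric (CPS) if for all $i,j,k,l\in\{1,\dots,n\}$: $\mathcal{A}_{ijkl}=\mathcal{A}_{jikl}=\mathcal{A}_{ijlk}$ and $\mathcal{A}_{ijkl}=\overline{\mathcal{A}_{klij}}$. For $X,Y\in\mathbb{C}^{n\times n}$ the outer product $X\circ Y$ is the tensor with entries $(X\circ Y)_{ijkl}=X_{ij}Y_{kl}$; $\overline{X}$ is the entrywise conjugate; $\langle X,Y\rangle=\sum_{i,j}X_{ij}\overline{Y_{ij}}$. An empty sum is zero. *)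

theory Defs
  imports "HOL-Analysis.Analysis"
begin

type_synonym 'n cmatrix = "complex ^ 'n ^ 'n"

type_synonym 'n ctensor4 = "complex ^ 'n ^ 'n ^ 'n ^ 'n"

definition conj_partial_symmetric :: "'n::finite ctensor4 \<Rightarrow> bool" where
  "conj_partial_symmetric A \<longleftrightarrow>
     (\<forall>i j k l. A $ i $ j $ k $ l = A $ j $ i $ k $ l \<and>
                A $ i $ j $ k $ l = A $ i $ j $ l $ k \<and>
                A $ i $ j $ k $ l = cnj (A $ k $ l $ i $ j))"

definition outer_product :: "'n::finite cmatrix \<Rightarrow> 'n cmatrix \<Rightarrow> 'n ctensor4" where
  "outer_product X Y = (\<chi> i j k l. X $ i $ j * Y $ k $ l)"

(* Complex-valued and conjugate-linear in the second argument; the library's inner on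
   this type is only its real part. *)
definition cinner_matrix :: "'n::finite cmatrix \<Rightarrow> 'n cmatrix \<Rightarrow> complex" where
  "cinner_matrix X Y = (\<Sum>i\<in>UNIV. \<Sum>j\<in>UNIV. X $ i $ j * cnj (Y $ i $ j))"

(* Only the values of lam and E on {1..r} matter. *)
definition cps_decomposition ::
  "'n::finite ctensor4 \<Rightarrow> nat \<Rightarrow> (nat \<Rightarrow> real) \<Rightarrow> (nat \<Rightarrow> 'n cmatrix) \<Rightarrow> bool" where
  "cps_decomposition A r lam E \<longleftrightarrow>
     (\<forall>i\<in>{1..r}. lam i \<noteq> 0) \<and>
     (\<forall>i\<in>{1..r}. transpose (E i) = E i) \<and>
     (\<forall>i\<in>{1..r}. \<forall>j\<in>{1..r}. cinner_matrix (E i) (E j) = (if i = j then 1 else 0)) \<and>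
     A = (\<Sum>i=1..r. lam i *\<^sub>R outer_product (E i) (map_matrix cnj (E i)))"

end

theory Submission
  imports Defs
begin

text \<open>
  A conjugate partial-symmetric tensor \<open>A\<close> is the coordinate form of the operator
  \<open>T\<close> that sends a matrix \<open>X\<close> to the matrix with entries
  \<open>\<Sum>k l. A\<^sub>i\<^sub>j\<^sub>k\<^sub>l X\<^sub>k\<^sub>l\<close>. The conjugate symmetry says that \<open>T\<close> is self-adjoint for the
  Hermitian form on matrices, the partial symmetry that every value of \<open>T\<close> is a symmetric
  matrix, and \<open>\<lambda> E \<circ> cnj E\<close> is the operator \<open>X \<mapsto> \<lambda> \<langle>X, E\<rangle> E\<close>. The
  decomposition is therefore the spectral decomposition of \<open>T\<close> without the kernel.

  For existence, a nonzero self-adjoint operator has a unit eigenvector \<open>E\<close> with an eigenvalue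
  \<open>\<lambda> \<noteq> 0\<close> (\<open>self_adjoint_nonzero_eigenvalue\<close>). Only the real part of the Hermitian form is
  used for this, so a real Euclidean space suffices and \<open>\<lambda>\<close> is real automatically. As
  \<open>E = T E / \<lambda>\<close> lies in the range of \<open>T\<close>, it is symmetric. Subtracting
  \<open>\<lambda> E \<circ> cnj E\<close> leaves a conjugate partial-symmetric tensor whose operator still kills the
  kernel of \<open>T\<close> and now kills \<open>E\<close> as well, so the kernel grows and the procedure stops. The
  eigenvectors found later belong to nonzero eigenvalues of an operator that kills \<open>E\<close>, hence
  are orthogonal to \<open>E\<close>.

  For uniqueness, each \<open>E'\<^sub>j\<close> of a second decomposition is an eigenvector of \<open>T\<close>. Expanded in
  the \<open>E\<^sub>i\<close>, it involves only those with \<open>\<lambda>\<^sub>i = \<lambda>'\<^sub>j\<close>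
  (\<open>eigenvector_meets_decomposition\<close>), and when the \<open>\<lambda>\<^sub>i\<close> are distinct this is a single
  one (\<open>simple_eigenvector_unique\<close>). Orthonormality on both sides makes the
  resulting map \<open>j \<mapsto> i\<close> a bijection.
\<close>

section \<open>Self-adjoint operators on a Euclidean space\<close>

text \<open>
  At a unit vector \<open>x\<close> where \<open>norm (T x)\<close> attains its maximum \<open>M\<close>, self-adjointness gives
  \<open>\<langle>T (T x), x\<rangle> = M\<^sup>2\<close> while \<open>norm (T (T x)) \<le> M\<^sup>2\<close>; this is the equality case of
  Cauchy-Schwarz, so \<open>T (T x) = M\<^sup>2 x\<close>. Factoring \<open>T\<^sup>2 - M\<^sup>2 = (T - M) (T + M)\<close> shows that
  \<open>M\<close> or \<open>- M\<close> is an eigenvalue.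
\<close>
lemma self_adjoint_nonzero_eigenvalue:
  fixes T :: "'a::euclidean_space \<Rightarrow> 'a"
  assumes lin: "linear T" and sa: "\<And>x y. T x \<bullet> y = x \<bullet> T y" and nz: "T z \<noteq> 0"
  obtains l e where "l \<noteq> 0" "norm e = 1" "T e = l *\<^sub>R e"
proof -
  interpret linear T by (rule lin)
  have "z \<noteq> 0" using nz by auto
  have "continuous_on (sphere 0 1) (\<lambda>x. norm (T x))"
    using lin by (intro continuous_on_norm linear_continuous_on)
      (simp add: linear_conv_bounded_linear)
  moreover have "sgn z \<in> sphere 0 1"
    using \<open>z \<noteq> 0\<close> by (simp add: norm_sgn)
  ultimately obtain x where x: "norm x = 1"
    and max: "\<And>y. norm y = 1 \<Longrightarrow> norm (T y) \<le> norm (T x)"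
    using continuous_attains_sup[of "sphere (0::'a) 1" "\<lambda>x. norm (T x)"] by auto
  define M where "M = norm (T x)"
  have bound: "norm (T y) \<le> M * norm y" for y
  proof (cases "y = 0")
    case False
    then have "norm (T (sgn y)) \<le> M"
      unfolding M_def by (intro max) (simp add: norm_sgn)
    then show ?thesis using False by (simp add: sgn_div_norm scale field_simps)
  qed (simp add: zero)
  have "M > 0"
    using bound[of z] nz \<open>z \<noteq> 0\<close>
    by (metis M_def mult_zero_left norm_ge_zero norm_le_zero_iff order_le_less)
  have "(norm (T (T x) - M\<^sup>2 *\<^sub>R x))\<^sup>2 = (norm (T (T x)))\<^sup>2 - 2 * M\<^sup>2 * (T (T x) \<bullet> x) + M^4"
    using x unfolding power2_norm_eq_inner
    by (simp add: inner_diff inner_commute algebra_simps power4_eq_xxxx power2_eq_square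
        flip: norm_eq_1)
  moreover have "T (T x) \<bullet> x = M\<^sup>2"
    using sa[of "T x" x] by (simp add: M_def power2_norm_eq_inner)
  moreover have "(norm (T (T x)))\<^sup>2 \<le> (M * M)\<^sup>2"
    using bound[of "T x"] by (intro power_mono) (auto simp: M_def)
  ultimately have "(norm (T (T x) - M\<^sup>2 *\<^sub>R x))\<^sup>2 \<le> 0"
    by (simp add: power4_eq_xxxx power2_eq_square algebra_simps)
  then have TT: "T (T x) = M\<^sup>2 *\<^sub>R x" by simp
  show thesis
  proof (cases "T x + M *\<^sub>R x = 0")
    case True
    then have "T x = (- M) *\<^sub>R x" by (simp add: add_eq_0_iff2)
    then show thesis using that[of "- M" x] x \<open>M > 0\<close> by simp
  next
    case False
    define y where "y = T x + M *\<^sub>R x"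
    have "T y = M *\<^sub>R y"
      by (simp add: y_def add scale TT power2_eq_square algebra_simps)
    then have "T (sgn y) = M *\<^sub>R sgn y"
      by (simp add: sgn_div_norm scale)
    moreover have "norm (sgn y) = 1" using False by (simp add: y_def norm_sgn)
    ultimately show thesis using that[of M "sgn y"] \<open>M > 0\<close> by simp
  qed
qed

section \<open>The Hermitian form on matrices\<close>

abbreviation cscale :: "complex \<Rightarrow> 'n::finite cmatrix \<Rightarrow> 'n cmatrix" where
  "cscale c X \<equiv> map_matrix (\<lambda>z. c * z) X"

lemma cscale_1 [simp]: "cscale 1 X = X"
  and cscale_0 [simp]: "cscale 0 X = 0"
  by (simp_all add: map_matrix_def vec_eq_iff)

text \<open>Rewriting inside the abstraction turns \<open>cscale 1\<close> and \<open>cscale 0\<close> into these forms.\<close>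
lemma map_matrix_ident [simp]: "map_matrix (\<lambda>z. z) X = X"
  and map_matrix_const_0 [simp]: "map_matrix (\<lambda>z. 0) X = 0"
  by (simp_all add: map_matrix_def vec_eq_iff)

lemma cinner_matrix_commute: "cinner_matrix Y X = cnj (cinner_matrix X Y)"
  by (simp add: cinner_matrix_def mult.commute)

lemma cinner_matrix_scaleR_left [simp]:
  "cinner_matrix (a *\<^sub>R X) Y = of_real a * cinner_matrix X Y"
  by (simp add: cinner_matrix_def sum_distrib_left scaleR_conv_of_real[of _ "_::complex"] mult.assoc)

lemma cinner_matrix_cscale_left [simp]:
  "cinner_matrix (cscale c X) Y = c * cinner_matrix X Y"
  by (simp add: cinner_matrix_def map_matrix_def sum_distrib_left mult.assoc)

lemma cinner_matrix_cscale_right [simp]: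
  "cinner_matrix X (cscale c Y) = cnj c * cinner_matrix X Y"
  by (simp add: cinner_matrix_def map_matrix_def sum_distrib_left algebra_simps)

lemma cinner_matrix_scaleR_right [simp]:
  "cinner_matrix X (a *\<^sub>R Y) = of_real a * cinner_matrix X Y"
  by (subst (1 2) cinner_matrix_commute) simp

lemma cinner_matrix_zero_left [simp]: "cinner_matrix 0 Y = 0"
  and cinner_matrix_zero_right [simp]: "cinner_matrix Y 0 = 0"
  by (simp_all add: cinner_matrix_def)

lemma cinner_matrix_add_left: "cinner_matrix (X + Z) Y = cinner_matrix X Y + cinner_matrix Z Y"
  by (simp add: cinner_matrix_def algebra_simps sum.distrib)

lemma cinner_matrix_sum_left:
  "cinner_matrix (\<Sum>i\<in>I. X i) Y = (\<Sum>i\<in>I. cinner_matrix (X i) Y)"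
  by (induction I rule: infinite_finite_induct) (simp_all add: cinner_matrix_add_left)

lemma Re_cinner_matrix: "Re (cinner_matrix X Y) = X \<bullet> Y"
  by (simp add: cinner_matrix_def inner_vec_def inner_complex_def)

lemma cinner_matrix_self: "cinner_matrix X X = of_real ((norm X)\<^sup>2)"
proof (rule complex_eqI)
  show "Re (cinner_matrix X X) = Re (of_real ((norm X)\<^sup>2))"
    by (simp add: Re_cinner_matrix power2_norm_eq_inner)
  show "Im (cinner_matrix X X) = Im (of_real ((norm X)\<^sup>2))"
    by (simp add: cinner_matrix_def)
qed

section \<open>The operator of a tensor\<close>

definition tensor_action :: "'n::finite ctensor4 \<Rightarrow> 'n cmatrix \<Rightarrow> 'n cmatrix" where
  "tensor_action A X = (\<chi> i j. \<Sum>k\<in>UNIV. \<Sum>l\<in>UNIV. A $ i $ j $ k $ l * X $ k $ l)"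

lemma linear_tensor_action: "linear (tensor_action A)"
  by (rule linearI)
    (simp_all add: tensor_action_def vec_eq_iff algebra_simps sum.distrib scaleR_right.sum)

lemma tensor_action_add_tensor:
  "tensor_action (A + B) X = tensor_action A X + tensor_action B X"
  by (simp add: tensor_action_def vec_eq_iff algebra_simps sum.distrib)

lemma tensor_action_diff_tensor:
  "tensor_action (A - B) X = tensor_action A X - tensor_action B X"
  by (simp add: tensor_action_def vec_eq_iff algebra_simps sum_subtractf)

lemma tensor_action_scaleR_tensor:
  "tensor_action (a *\<^sub>R A) X = a *\<^sub>R tensor_action A X"
  by (simp add: tensor_action_def vec_eq_iff scaleR_right.sum)

lemma tensor_action_sum_tensor:
  "tensor_action (\<Sum>i\<in>I. A i) X = (\<Sum>i\<in>I. tensor_action (A i) X)"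
proof (induction I rule: infinite_finite_induct)
  case (insert i I)
  then show ?case by (simp add: tensor_action_add_tensor)
qed (simp_all add: tensor_action_def vec_eq_iff)

lemma tensor_action_outer_product:
  "tensor_action (outer_product E (map_matrix cnj F)) X = cscale (cinner_matrix X F) E"
  by (simp add: tensor_action_def outer_product_def cinner_matrix_def map_matrix_def vec_eq_iff
      sum_distrib_left algebra_simps)

text \<open>The tensor is recovered by letting its operator act on matrix units.\<close>
lemma tensor_eq_0_if_action_0:
  assumes "\<And>X. tensor_action A X = 0"
  shows "A = 0"
proof -
  have "A $ i $ j $ k $ l = 0" for i j k l
  proof -
    have "tensor_action A (\<chi> k' l'. if k' = k then if l' = l then 1 else 0 else 0) $ i $ j
        = A $ i $ j $ k $ l"
      by (simp add: tensor_action_def if_distrib[of "\<lambda>x. _ * x"] sum.If_cases cong: if_cong)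
    then show ?thesis by (simp add: assms)
  qed
  then show ?thesis by (simp add: vec_eq_iff)
qed

lemma tensor_action_self_adjoint:
  fixes A :: "'n::finite ctensor4"
  assumes "conj_partial_symmetric A"
  shows "cinner_matrix (tensor_action A X) Y = cinner_matrix X (tensor_action A Y)"
proof -
  have A: "cnj (A $ k $ l $ i $ j) = A $ i $ j $ k $ l" for i j k l
    using assms unfolding conj_partial_symmetric_def by metis
  have swap: "(\<Sum>a\<in>UNIV. \<Sum>k\<in>UNIV. \<Sum>l\<in>UNIV. f a k l)
      = (\<Sum>k\<in>UNIV. \<Sum>l\<in>UNIV. \<Sum>a\<in>UNIV. f a k l)" for f :: "'n \<Rightarrow> 'n \<Rightarrow> 'n \<Rightarrow> complex"
    by (subst sum.swap) (intro sum.cong refl sum.swap)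
  let ?f = "\<lambda>i j k l. A $ i $ j $ k $ l * X $ k $ l * cnj (Y $ i $ j)"
  have "cinner_matrix (tensor_action A X) Y
      = (\<Sum>i\<in>UNIV. \<Sum>j\<in>UNIV. \<Sum>k\<in>UNIV. \<Sum>l\<in>UNIV. ?f i j k l)"
    by (simp add: cinner_matrix_def tensor_action_def sum_distrib_right)
  also have "\<dots> = (\<Sum>i\<in>UNIV. \<Sum>k\<in>UNIV. \<Sum>l\<in>UNIV. \<Sum>j\<in>UNIV. ?f i j k l)"
    by (intro sum.cong refl swap)
  also have "\<dots> = (\<Sum>k\<in>UNIV. \<Sum>l\<in>UNIV. \<Sum>i\<in>UNIV. \<Sum>j\<in>UNIV. ?f i j k l)"
    by (rule swap)
  also have "\<dots> = cinner_matrix X (tensor_action A Y)"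
    by (simp add: cinner_matrix_def tensor_action_def sum_distrib_left A algebra_simps)
  finally show ?thesis .
qed

lemma transpose_tensor_action:
  assumes "conj_partial_symmetric A"
  shows "transpose (tensor_action A X) = tensor_action A X"
proof -
  have "A $ j $ i $ k $ l = A $ i $ j $ k $ l" for i j k l
    using assms unfolding conj_partial_symmetric_def by metis
  then show ?thesis by (simp add: transpose_def tensor_action_def vec_eq_iff)
qed

lemma eigenmatrix_symmetric:
  assumes "conj_partial_symmetric A" "tensor_action A E = l *\<^sub>R E" "l \<noteq> 0"
  shows "transpose E = E"
proof -
  have "transpose (l *\<^sub>R E) = l *\<^sub>R E"
    using transpose_tensor_action[OF assms(1), of E] assms(2) by simp
  then show ?thesis using assms(3) by (simp add: transpose_def vec_eq_iff)
qed

lemma conj_partial_symmetric_deflate: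
  assumes "conj_partial_symmetric A" "transpose E = E"
  shows "conj_partial_symmetric (A - l *\<^sub>R outer_product E (map_matrix cnj E))"
proof -
  have E: "E $ i $ j = E $ j $ i" for i j
    by (metis assms(2) transpose_def vec_lambda_beta)
  show ?thesis
    unfolding conj_partial_symmetric_def
  proof (intro allI conjI)
    fix i j k m
    have A: "A $ i $ j $ k $ m = A $ j $ i $ k $ m" "A $ i $ j $ k $ m = A $ i $ j $ m $ k"
      "A $ i $ j $ k $ m = cnj (A $ k $ m $ i $ j)"
      using assms(1) unfolding conj_partial_symmetric_def by blast+
    let ?B = "A - l *\<^sub>R outer_product E (map_matrix cnj E)"
    show "?B $ i $ j $ k $ m = ?B $ j $ i $ k $ m"
      using A(1) E[of i j] by (simp add: outer_product_def map_matrix_def)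
    show "?B $ i $ j $ k $ m = ?B $ i $ j $ m $ k"
      using A(2) E[of k m] by (simp add: outer_product_def map_matrix_def)
    show "?B $ i $ j $ k $ m = cnj (?B $ k $ m $ i $ j)"
      using A(3) by (simp add: outer_product_def map_matrix_def)
  qed
qed

section \<open>Decompositions as spectral data\<close>

lemma tensor_action_decomposition:
  assumes "cps_decomposition A r lam E"
  shows "tensor_action A X = (\<Sum>i=1..r. lam i *\<^sub>R cscale (cinner_matrix X (E i)) (E i))"
proof -
  have "A = (\<Sum>i=1..r. lam i *\<^sub>R outer_product (E i) (map_matrix cnj (E i)))"
    using assms by (simp add: cps_decomposition_def)
  then show ?thesis
    by (simp add: tensor_action_sum_tensor tensor_action_scaleR_tensor
        tensor_action_outer_product)
qed

lemma decomposition_eigenmatrix: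
  assumes "cps_decomposition A r lam E" "j \<in> {1..r}"
  shows "tensor_action A (E j) = lam j *\<^sub>R E j"
proof -
  have "tensor_action A (E j)
      = (\<Sum>i=1..r. if i = j then lam j *\<^sub>R E j else 0)"
    unfolding tensor_action_decomposition[OF assms(1)]
    using assms by (intro sum.cong refl) (auto simp: cps_decomposition_def)
  then show ?thesis using assms(2) by simp
qed

lemma decomposition_coefficient:
  assumes "cps_decomposition A r lam E" "i \<in> {1..r}"
  shows "cinner_matrix (tensor_action A X) (E i) = lam i * cinner_matrix X (E i)"
proof -
  have "cinner_matrix (tensor_action A X) (E i)
      = (\<Sum>k=1..r. if k = i then lam i * cinner_matrix X (E i) else 0)"
    unfolding tensor_action_decomposition[OF assms(1)] cinner_matrix_sum_left
    using assms by (intro sum.cong refl) (auto simp: cps_decomposition_def)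
  then show ?thesis using assms(2) by simp
qed

lemma decomposition_coefficient_eq_0:
  assumes "cps_decomposition A r lam E" "i \<in> {1..r}"
    and "tensor_action A X = mu *\<^sub>R X" "lam i \<noteq> mu"
  shows "cinner_matrix X (E i) = 0"
  using decomposition_coefficient[OF assms(1,2), of X] assms(3,4) by simp

text \<open>
  The matrices of a decomposition need not span the whole space, but they span the range of the
  operator, which contains every eigenvector with nonzero eigenvalue.
\<close>
lemma eigenvector_meets_decomposition:
  assumes "cps_decomposition A r lam E" "tensor_action A X = mu *\<^sub>R X" "mu \<noteq> 0" "X \<noteq> 0"
  obtains i where "i \<in> {1..r}" "cinner_matrix X (E i) \<noteq> 0" "lam i = mu"
proof -
  have "\<exists>i\<in>{1..r}. cinner_matrix X (E i) \<noteq> 0"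
  proof (rule ccontr)
    assume "\<not> ?thesis"
    then have "tensor_action A X = 0"
      unfolding tensor_action_decomposition[OF assms(1)]
      by (intro sum.neutral) auto
    then show False using assms by simp
  qed
  then show thesis
    using that decomposition_coefficient_eq_0[OF assms(1) _ assms(2)] by blast
qed

lemma simple_eigenvector_unique:
  assumes dec: "cps_decomposition A r lam E" and inj: "inj_on lam {1..r}"
    and i: "i \<in> {1..r}" and X: "tensor_action A X = lam i *\<^sub>R X"
  shows "X = cscale (cinner_matrix X (E i)) (E i)"
proof -
  have "tensor_action A X
      = (\<Sum>k=1..r. if k = i then lam i *\<^sub>R cscale (cinner_matrix X (E i)) (E i) else 0)"
    unfolding tensor_action_decomposition[OF dec]
  proof (intro sum.cong refl)
    fix k assume k: "k \<in> {1..r}"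
    have "cinner_matrix X (E k) = 0" if "k \<noteq> i"
      using decomposition_coefficient_eq_0[OF dec k X] inj_onD[OF inj _ k i] that by blast
    then show "lam k *\<^sub>R cscale (cinner_matrix X (E k)) (E k)
        = (if k = i then lam i *\<^sub>R cscale (cinner_matrix X (E i)) (E i) else 0)"
      by auto
  qed
  then have "lam i *\<^sub>R X = lam i *\<^sub>R cscale (cinner_matrix X (E i)) (E i)"
    using X i by simp
  moreover have "lam i \<noteq> 0" using dec i by (simp add: cps_decomposition_def)
  ultimately show ?thesis by simp
qed

section \<open>Existence\<close>

text \<open>
  One deflation step. The matrices decomposing the deflated tensor are orthogonal to the removed
  \<open>F\<close> because the deflated operator kills \<open>F\<close> but acts on them with nonzero eigenvalues.
\<close>
lemma cps_decomposition_undeflate: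
  assumes l: "l \<noteq> 0" and F: "transpose F = F" "norm F = 1" and TF: "tensor_action A F = l *\<^sub>R F"
    and dec: "cps_decomposition (A - l *\<^sub>R outer_product F (map_matrix cnj F)) r lam E"
  shows "cps_decomposition A (Suc r) (lam(Suc r := l)) (E(Suc r := F))"
proof -
  let ?B = "A - l *\<^sub>R outer_product F (map_matrix cnj F)"
  have FF: "cinner_matrix F F = 1" using F by (simp add: cinner_matrix_self)
  have "tensor_action ?B F = 0 *\<^sub>R F"
    by (simp add: tensor_action_diff_tensor tensor_action_scaleR_tensor
        tensor_action_outer_product TF FF)
  then have orth: "cinner_matrix F (E i) = 0" if "i \<in> {1..r}" for i
  proof (rule decomposition_coefficient_eq_0[OF dec that])
    show "lam i \<noteq> 0" using dec that by (simp add: cps_decomposition_def)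
  qed
  then have orth': "cinner_matrix (E i) F = 0" if "i \<in> {1..r}" for i
    using cinner_matrix_commute[of "E i" F] that by simp
  have "(\<Sum>i=1..r. lam i *\<^sub>R outer_product (E i) (map_matrix cnj (E i)))
      = A - l *\<^sub>R outer_product F (map_matrix cnj F)"
    using dec by (simp add: cps_decomposition_def)
  moreover have "(\<Sum>i=1..r. (lam(Suc r := l)) i *\<^sub>R
        outer_product ((E(Suc r := F)) i) (map_matrix cnj ((E(Suc r := F)) i)))
      = (\<Sum>i=1..r. lam i *\<^sub>R outer_product (E i) (map_matrix cnj (E i)))"
    by (intro sum.cong) auto
  ultimately have "A = (\<Sum>i=1..Suc r. (lam(Suc r := l)) i *\<^sub>R
        outer_product ((E(Suc r := F)) i) (map_matrix cnj ((E(Suc r := F)) i)))"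
    by (simp add: sum.cl_ivl_Suc del: fun_upd_apply) simp
  moreover have "{1..Suc r} = insert (Suc r) {1..r}" by auto
  ultimately show ?thesis
    using dec l F FF orth orth' by (auto simp: cps_decomposition_def)
qed

text \<open>
  Deflation does not visibly shrink the tensor, so the induction runs on the codimension of the
  kernel of its operator, taken as a real subspace.
\<close>
lemma cps_decomposition_exists:
  fixes A :: "'n::finite ctensor4"
  assumes "conj_partial_symmetric A"
  shows "\<exists>r lam E. cps_decomposition A r lam E"
  using assms
proof (induction "DIM('n cmatrix) - dim {X. tensor_action A X = 0}" arbitrary: A rule: less_induct)
  case less
  show ?case
  proof (cases "A = 0")
    case True
    then have "cps_decomposition A 0 (\<lambda>_. 0) (\<lambda>_. 0)" by (simp add: cps_decomposition_def)
    then show ?thesis by blast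
  next
    case False
    then obtain Z where "tensor_action A Z \<noteq> 0" using tensor_eq_0_if_action_0 by blast
    moreover have "tensor_action A X \<bullet> Y = X \<bullet> tensor_action A Y" for X Y
      by (simp add: tensor_action_self_adjoint[OF less.prems] flip: Re_cinner_matrix)
    ultimately obtain l F where l: "l \<noteq> 0" and F: "norm F = 1" and TF: "tensor_action A F = l *\<^sub>R F"
      using self_adjoint_nonzero_eigenvalue[OF linear_tensor_action] by metis
    have sym: "transpose F = F" using eigenmatrix_symmetric less.prems TF l by blast
    have FF: "cinner_matrix F F = 1" using F by (simp add: cinner_matrix_self)
    define B where "B = A - l *\<^sub>R outer_product F (map_matrix cnj F)"
    have TB: "tensor_action B X = tensor_action A X - l *\<^sub>R cscale (cinner_matrix X F) F" for X
      by (simp add: B_def tensor_action_diff_tensor tensor_action_scaleR_tensor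
          tensor_action_outer_product)
    have sub: "subspace {X. tensor_action C X = 0}" for C :: "'n ctensor4"
      using linear_subspace_kernel[OF linear_tensor_action] .
    have "{X. tensor_action A X = 0} \<subset> {X. tensor_action B X = 0}"
    proof (rule psubsetI)
      show "{X. tensor_action A X = 0} \<subseteq> {X. tensor_action B X = 0}"
      proof clarify
        fix X assume X: "tensor_action A X = 0"
        \<comment> \<open>Self-adjointness makes the kernel orthogonal to eigenvectors with \<open>l \<noteq> 0\<close>.\<close>
        have "l * cinner_matrix X F = cinner_matrix X (tensor_action A F)" by (simp add: TF)
        also have "\<dots> = 0" using tensor_action_self_adjoint[OF less.prems, of X F] X by simp
        finally show "tensor_action B X = 0"
          using l X by (simp add: TB)
      qed
      have "tensor_action B F = 0" by (simp add: TB TF FF)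
      moreover have "tensor_action A F \<noteq> 0" using TF l F by auto
      ultimately show "{X. tensor_action A X = 0} \<noteq> {X. tensor_action B X = 0}" by blast
    qed
    then have "dim {X. tensor_action A X = 0} < dim {X. tensor_action B X = 0}"
      by (intro dim_psubset) (simp add: span_eq_iff[THEN iffD2, OF sub])
    moreover have "dim {X. tensor_action B X = 0} \<le> DIM('n cmatrix)" by (rule dim_subset_UNIV)
    ultimately have "DIM('n cmatrix) - dim {X. tensor_action B X = 0}
        < DIM('n cmatrix) - dim {X. tensor_action A X = 0}"
      by linarith
    moreover have "conj_partial_symmetric B"
      unfolding B_def using conj_partial_symmetric_deflate less.prems sym by blast
    ultimately obtain r lam E where "cps_decomposition B r lam E" using less.hyps by blast
    then show ?thesis
      using cps_decomposition_undeflate[OF l sym F TF] unfolding B_def by blast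
  qed
qed

section \<open>Uniqueness\<close>

text \<open>
  Distinctness is assumed only of \<open>lam\<close>: it is what turns each \<open>E' j\<close> into a multiple of one
  \<open>E (q j)\<close>. Injectivity of \<open>q\<close> then comes from the orthogonality of the \<open>E' j\<close>, and
  surjectivity from expanding the \<open>E i\<close> in the \<open>E' j\<close>.
\<close>
lemma cps_decomposition_unique:
  assumes dec: "cps_decomposition A r lam E" and inj: "inj_on lam {1..r}"
    and dec': "cps_decomposition A r' lam' E'"
  shows "r' = r \<and> (\<exists>p c. p permutes {1..r} \<and>
          (\<forall>i\<in>{1..r}. cmod (c i) = 1 \<and> lam' i = lam (p i) \<and> E' i = cscale (c i) (E (p i))))"
proof -
  have on: "cinner_matrix (E i) (E j) = (if i = j then 1 else 0)"
    if "i \<in> {1..r}" "j \<in> {1..r}" for i j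
    using dec that by (simp add: cps_decomposition_def)
  have on': "cinner_matrix (E' i) (E' j) = (if i = j then 1 else 0)"
    if "i \<in> {1..r'}" "j \<in> {1..r'}" for i j
    using dec' that by (simp add: cps_decomposition_def)
  have "\<exists>i\<in>{1..r}. lam' j = lam i \<and> E' j = cscale (cinner_matrix (E' j) (E i)) (E i)"
    if j: "j \<in> {1..r'}" for j
  proof -
    have eig: "tensor_action A (E' j) = lam' j *\<^sub>R E' j"
      by (rule decomposition_eigenmatrix[OF dec' j])
    have "lam' j \<noteq> 0" using dec' j by (simp add: cps_decomposition_def)
    moreover have "E' j \<noteq> 0" using on'[OF j j] by auto
    ultimately obtain i where "i \<in> {1..r}" "lam i = lam' j"
      using eigenvector_meets_decomposition[OF dec eig] by metis
    then show ?thesis using simple_eigenvector_unique[OF dec inj] eig by metis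
  qed
  then obtain q where q: "\<And>j. j \<in> {1..r'} \<Longrightarrow> q j \<in> {1..r}"
      "\<And>j. j \<in> {1..r'} \<Longrightarrow> lam' j = lam (q j)"
      "\<And>j. j \<in> {1..r'} \<Longrightarrow> E' j = cscale (cinner_matrix (E' j) (E (q j))) (E (q j))"
    by metis
  define c where "c j = cinner_matrix (E' j) (E (q j))" for j
  have E': "E' j = cscale (c j) (E (q j))" if "j \<in> {1..r'}" for j
    using q(3)[OF that] by (simp add: c_def)
  have c: "cmod (c j) = 1" if j: "j \<in> {1..r'}" for j
  proof -
    have "c j * cnj (c j) = cinner_matrix (E' j) (E' j)"
      unfolding E'[OF j] using on[OF q(1)[OF j] q(1)[OF j]] by (simp add: mult.commute)
    then have "complex_of_real ((cmod (c j))\<^sup>2) = 1"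
      using on'[OF j j] by (simp only: complex_norm_square) simp
    then have "(cmod (c j))\<^sup>2 = 1" by (simp only: of_real_eq_1_iff)
    then show ?thesis by (simp add: power2_eq_1_iff) (smt (verit) norm_ge_zero)
  qed
  have "inj_on q {1..r'}"
  proof (rule inj_onI, rule ccontr)
    fix i j assume ij: "i \<in> {1..r'}" "j \<in> {1..r'}" "q i = q j" "i \<noteq> j"
    have "cinner_matrix (E' i) (E' j) = cnj (c j) * c i"
      unfolding E'[OF ij(1)] E'[OF ij(2)] using on[OF q(1)[OF ij(2)] q(1)[OF ij(2)]] ij(3) by simp
    then show False using on'[OF ij(1,2)] ij(4) c[OF ij(1)] c[OF ij(2)] by auto
  qed
  moreover have "q ` {1..r'} = {1..r}"
  proof
    show "{1..r} \<subseteq> q ` {1..r'}"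
    proof
      fix i assume i: "i \<in> {1..r}"
      have "lam i \<noteq> 0" using dec i by (simp add: cps_decomposition_def)
      moreover have "E i \<noteq> 0" using on[OF i i] by auto
      ultimately obtain j where j: "j \<in> {1..r'}" "cinner_matrix (E i) (E' j) \<noteq> 0"
        using eigenvector_meets_decomposition[OF dec' decomposition_eigenmatrix[OF dec i]] by metis
      have "cinner_matrix (E i) (E (q j)) \<noteq> 0"
        using j(2) unfolding E'[OF j(1)] by simp
      then have "i = q j" using on[OF i q(1)[OF j(1)]] by (auto split: if_splits)
      then show "i \<in> q ` {1..r'}" using j(1) by blast
    qed
  qed (use q(1) in blast)
  ultimately have bij: "bij_betw q {1..r'} {1..r}" by (simp add: bij_betw_def)
  then have r: "r' = r" using bij_betw_same_card by fastforce
  \<comment> \<open>A permutation of \<open>{1..r}\<close> must fix everything else, where \<open>q\<close> is arbitrary.\<close>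
  define p where "p i = (if i \<in> {1..r} then q i else i)" for i
  have "bij_betw p {1..r} {1..r}"
    using bij r by (subst bij_betw_cong[of _ _ q]) (auto simp: p_def)
  then have "p permutes {1..r}"
    by (rule bij_imp_permutes) (auto simp: p_def)
  moreover have "\<forall>i\<in>{1..r}. cmod (c i) = 1 \<and> lam' i = lam (p i) \<and> E' i = cscale (c i) (E (p i))"
    using c q(2) E' r by (simp add: p_def)
  ultimately show ?thesis using r by blast
qed

theorem theorem1:
  fixes A :: "complex ^ 'n::finite ^ 'n ^ 'n ^ 'n"
  assumes "conj_partial_symmetric A"
  shows "(\<exists>r lam E. cps_decomposition A r lam E) \<and>
    (\<forall>r lam E. cps_decomposition A r lam E \<and> inj_on lam {1..r} \<longrightarrow>
      (\<forall>r' lam' E'. cps_decomposition A r' lam' E' \<longrightarrow>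
        r' = r \<and>
        (\<exists>p c. p permutes {1..r} \<and>
          (\<forall>i\<in>{1..r}. cmod (c i) = 1 \<and> lam' i = lam (p i) \<and>
             E' i = map_matrix (\<lambda>z. c i * z) (E (p i))))))"
  using cps_decomposition_exists[OF assms] cps_decomposition_unique by blast

end
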